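(* Let $X$ be a real separated (Hausdorff) locally convex space and let $f,g:X\to\overline{\mathbb R}$ be proper functions such that $v(P_F)\in\mathbb R$ and the set $E_F=\operatorname{epi}f-\widehat{\operatorname{epi}}(g-v(P_F))$ is a convex subset of $X\times\mathbb R$ (the latter is the case if, for instance, $f$ and $g$ are convex). Suppose that either $f$ and $g$ are convex and (RC6') holds, or one of (RC6), (RC7) holds, where: (RC6') $\operatorname{dom}f\cap\operatorname{qri}(\operatorname{dom}g)\neq\emptyset$, $0\in\operatorname{qi}(\operatorname{dom}g-\operatorname{dom}g)$ and $(0,0)\notin\operatorname{qri}[\operatorname{co}(E_F\cup\{(0,0)\})]$; (RC6) $0\in\operatorname{qi}(\operatorname{dom}f-\operatorname{dom}g)$ and $(0,0)\notin\operatorname{qri}[\operatorname{co}(E_F\cup\{(0,0)\})]$; (RC7) $0\in\operatorname{qi}[(\operatorname{dom}f-\operatorname{dom}g)-(\operatorname{dom}f-\operatorname{dom}g)]$, $0\in\operatorname{qri}(\operatorname{dom}f-\operatorname{dom}g)$ and $(0,0)\notin\operatorname{qri}[\operatorname{co}(E_F\cup\{(0,0)\})]$. Then $v(P_F)=v(D_F)$ and $(D_F)$ has an optimal solution.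
   Context: $\overline{\mathbb R}=\mathbb R\cup\{\pm\infty\}$. For $h:X\to\overline{\mathbb R}$: $\operatorname{dom}h=\{x:h(x)<+\infty\}$, $\operatorname{epi}h=\{(x,r)\in X\times\mathbb R:h(x)\le r\}$, $\widehat{\operatorname{epi}}(h)=\{(x,r)\in X\times\mathbb R:(x,-r)\in\operatorname{epi}h\}$; $h$ is proper if $\operatorname{dom}h\neq\emptyset$ and $h>-\infty$ everywhere; $h^*(x^* )=\sup_{x\in X}\{\langle x^*,x\rangle-h(x)\}$ for $x^*\in X^*$, the topological dual of $X$. Primal problem $(P_F)$: $\inf_{x\in X}\{f(x)+g(x)\}$, with optimal value $v(P_F)$. Fenchel dual $(D_F)$: $\sup_{y^*\in X^*}\{-f^*(-y^* )-g^*(y^* )\}$, with optimal value $v(D_F)$; an optimal solution is a $y^*$ attaining the supremum. $E_F=\operatorname{epi}f-\widehat{\operatorname{epi}}(g-v(P_F))=\{(x-y,f(x)+g(y)-v(P_F)+\varepsilon):x\in\operatorname{dom}f,\ y\in\operatorname{dom}g,\ \varepsilon\ge0\}$. For a nonempty convex subset $U$ of a separated locally convex space $V$, $\operatorname{cone}(U)=\bigcup_{t\ge0}tU$; $\operatorname{qi}(U)=\{u\in U:\operatorname{cl}(\operatorname{cone}(U-u))=V\}$ (quasi interior); $\operatorname{qri}(U)=\{u\in U:\operatorname{cl}(\operatorname{cone}(U-u))\text{ is a linear subspace of }V\}$ (quasi-relative interior). $\operatorname{co}$ is the convex hull, $\operatorname{cl}$ the closure. *)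

theory Defs
  imports "HOL-Analysis.Analysis"
begin

class locally_convex_space = real_vector + topological_ab_group_add + t2_space +
  assumes tendsto_scaleR_Pair:
    "LIM z (nhds c \<times>\<^sub>F nhds x). fst z *\<^sub>R snd z :> nhds (c *\<^sub>R x)"
  assumes ex_convex_open_nhd_zero:
    "open U \<Longrightarrow> 0 \<in> U \<Longrightarrow> \<exists>C. open C \<and> 0 \<in> C \<and> C \<subseteq> U \<and>
       (\<forall>x\<in>C. \<forall>y\<in>C. \<forall>u\<ge>0. \<forall>v\<ge>0. u + v = 1 \<longrightarrow> u *\<^sub>R x + v *\<^sub>R y \<in> C)"

text \<open>The class axiom spells out \<^const>\<open>convex\<close>, which is not available inside a class
  specification.\<close>

lemma ex_convex_open_nhd_zero':
  fixes U :: "'a::locally_convex_space set"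
  assumes "open U" "0 \<in> U"
  shows "\<exists>C. open C \<and> convex C \<and> 0 \<in> C \<and> C \<subseteq> U"
  using ex_convex_open_nhd_zero[OF assms] unfolding convex_def by blast

instance real_normed_vector \<subseteq> locally_convex_space
proof
  fix c :: real and x :: 'a
  show "LIM z (nhds c \<times>\<^sub>F nhds x). fst z *\<^sub>R snd z :> nhds (c *\<^sub>R x)"
    by (intro tendsto_scaleR filterlim_fst filterlim_snd)
next
  fix U :: "'a set"
  assume "open U" "0 \<in> U"
  then obtain e where "e > 0" "ball 0 e \<subseteq> U"
    by (auto simp: open_contains_ball)
  then have "open (ball (0::'a) e) \<and> 0 \<in> ball (0::'a) e \<and> ball 0 e \<subseteq> U \<and> convex (ball (0::'a) e)"
    by simp
  then show "\<exists>C. open C \<and> 0 \<in> C \<and> C \<subseteq> U \<and>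
      (\<forall>x\<in>C. \<forall>y\<in>C. \<forall>u\<ge>0. \<forall>v\<ge>0. u + v = 1 \<longrightarrow> u *\<^sub>R x + v *\<^sub>R y \<in> C)"
    unfolding convex_def by blast
qed

definition topological_dual :: "('a::locally_convex_space \<Rightarrow> real) set" where
  "topological_dual = {y. linear y \<and> continuous_on UNIV y}"

text \<open>The symbol \<open>-\<close> on sets denotes set difference in HOL, hence a separate operator.\<close>

definition minkowski_diff :: "'a::minus set \<Rightarrow> 'a set \<Rightarrow> 'a set" where
  "minkowski_diff A B = {a - b | a b. a \<in> A \<and> b \<in> B}"

text \<open>The library constant \<^const>\<open>cone\<close> is a predicate; the following is the cone generated
  by a set.\<close>

definition generated_cone :: "'a::real_vector set \<Rightarrow> 'a set" where
  "generated_cone U = (\<Union>t\<in>{0..}. (\<lambda>u. t *\<^sub>R u) ` U)"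

definition qi :: "'a::{real_vector, topological_space} set \<Rightarrow> 'a set" where
  "qi U = {u \<in> U. closure (generated_cone ((\<lambda>x. x - u) ` U)) = UNIV}"

definition qri :: "'a::{real_vector, topological_space} set \<Rightarrow> 'a set" where
  "qri U = {u \<in> U. subspace (closure (generated_cone ((\<lambda>x. x - u) ` U)))}"

definition edom :: "('a \<Rightarrow> ereal) \<Rightarrow> 'a set" where
  "edom h = {x. h x < \<infinity>}"

definition epi :: "('a \<Rightarrow> ereal) \<Rightarrow> ('a \<times> real) set" where
  "epi h = {(x, r). h x \<le> ereal r}"

definition epi_hat :: "('a \<Rightarrow> ereal) \<Rightarrow> ('a \<times> real) set" where
  "epi_hat h = {(x, r). (x, - r) \<in> epi h}"

definition proper :: "('a \<Rightarrow> ereal) \<Rightarrow> bool" where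
  "proper h \<longleftrightarrow> edom h \<noteq> {} \<and> (\<forall>x. h x > - \<infinity>)"

text \<open>In \<^typ>\<open>ereal\<close> we have \<open>0 * \<infinity> = 0\<close> and \<open>\<infinity> + - \<infinity> = \<infinity>\<close>, so the inequality is automatic
  whenever one of the function values is \<open>\<infinity>\<close> or one of the coefficients vanishes.\<close>

definition ereal_convex :: "('a::real_vector \<Rightarrow> ereal) \<Rightarrow> bool" where
  "ereal_convex h \<longleftrightarrow> (\<forall>x y. \<forall>t\<in>{0..1}.
     h (t *\<^sub>R x + (1 - t) *\<^sub>R y) \<le> ereal t * h x + ereal (1 - t) * h y)"

definition conjugate :: "('a \<Rightarrow> ereal) \<Rightarrow> ('a \<Rightarrow> real) \<Rightarrow> ereal" where
  "conjugate h y = (SUP x. ereal (y x) - h x)"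

definition primal_value :: "('a \<Rightarrow> ereal) \<Rightarrow> ('a \<Rightarrow> ereal) \<Rightarrow> ereal" where
  "primal_value f g = (INF x. f x + g x)"

definition dual_objective ::
    "('a \<Rightarrow> ereal) \<Rightarrow> ('a \<Rightarrow> ereal) \<Rightarrow> ('a \<Rightarrow> real) \<Rightarrow> ereal" where
  "dual_objective f g y = - conjugate f (\<lambda>x. - y x) - conjugate g y"

definition dual_value ::
    "('a::locally_convex_space \<Rightarrow> ereal) \<Rightarrow> ('a \<Rightarrow> ereal) \<Rightarrow> ereal" where
  "dual_value f g = (SUP y\<in>topological_dual. dual_objective f g y)"

definition dual_optimal_solution ::
    "('a::locally_convex_space \<Rightarrow> ereal) \<Rightarrow> ('a \<Rightarrow> ereal) \<Rightarrow> ('a \<Rightarrow> real) \<Rightarrow> bool" where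
  "dual_optimal_solution f g y \<longleftrightarrow>
     y \<in> topological_dual \<and> dual_objective f g y = dual_value f g"

definition E_F ::
    "('a::real_vector \<Rightarrow> ereal) \<Rightarrow> ('a \<Rightarrow> ereal) \<Rightarrow> ('a \<times> real) set" where
  "E_F f g = minkowski_diff (epi f) (epi_hat (\<lambda>x. g x - primal_value f g))"

lemma E_F_eq:
  fixes f g :: "'a::real_vector \<Rightarrow> ereal"
  assumes "proper f" "proper g" and v: "primal_value f g = ereal v"
  shows "E_F f g =
    {(x - y, real_of_ereal (f x) + real_of_ereal (g y) - v + e) | x y e.
       x \<in> edom f \<and> y \<in> edom g \<and> e \<ge> 0}" (is "_ = ?R")
proof (intro equalityI subsetI)
  fix z assume "z \<in> E_F f g"
  then obtain x y r s where z: "z = (x - y, r - s)"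
    and r: "f x \<le> ereal r" and s: "g y - ereal v \<le> ereal (- s)"
    by (auto simp: E_F_def minkowski_diff_def epi_def epi_hat_def v)
  obtain a where a: "f x = ereal a"
    using r assms(1) by (cases "f x") (auto simp: proper_def)
  obtain b where b: "g y = ereal b"
    using s assms(2) by (cases "g y") (auto simp: proper_def)
  have "z = (x - y, a + b - v + (r - s - a - b + v))" "r - s - a - b + v \<ge> 0"
    using r s z a b by auto
  then show "z \<in> ?R"
    using a b by (intro CollectI exI[of _ x] exI[of _ y] exI[of _ "r - s - a - b + v"])
      (auto simp: edom_def)
next
  fix z assume "z \<in> ?R"
  then obtain x y e where z: "z = (x - y, real_of_ereal (f x) + real_of_ereal (g y) - v + e)"
    and x: "x \<in> edom f" and y: "y \<in> edom g" and e: "e \<ge> 0" by auto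
  obtain a where a: "f x = ereal a"
    using x assms(1) by (cases "f x") (auto simp: proper_def edom_def)
  obtain b where b: "g y = ereal b"
    using y assms(2) by (cases "g y") (auto simp: proper_def edom_def)
  have "z = (x, a + e) - (y, v - b)"
    using z a b by simp
  moreover have "(x, a + e) \<in> epi f" "(y, v - b) \<in> epi_hat (\<lambda>x. g x - ereal v)"
    using a b e by (auto simp: epi_def epi_hat_def)
  ultimately show "z \<in> E_F f g"
    unfolding E_F_def minkowski_diff_def v by blast
qed

end

theory Submission
  imports Defs
begin

text \<open>Write \<open>v\<close> for the primal value and \<open>U\<close> for the convex hull of \<open>E_F \<union> {(0, 0)}\<close>. That \<open>(0, 0)\<close> is not
  in \<open>qri U\<close> says that the closed convex cone \<open>K\<close> generated by \<open>U\<close> is not a linear subspace: there is a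
  \<open>z \<in> K\<close> with \<open>- z \<notin> K\<close>. Separating \<open>- z\<close> from \<open>K\<close> yields a continuous linear functional
  \<open>(x, s) \<mapsto> p x + r * s\<close> on \<open>X \<times> \<real>\<close> that is nonnegative on \<open>E_F\<close> but not identically zero there
  (lemma \<open>proper_separation_of_not_qri\<close>). As \<open>E_F\<close> is unbounded above in its real component, \<open>r \<ge> 0\<close>.

  If \<open>r > 0\<close>, division by \<open>r\<close> gives \<open>q = p / r\<close> in the dual space with
  \<open>(q x + f x) + (g y - q y) \<ge> v\<close> for all \<open>x \<in> dom f\<close> and \<open>y \<in> dom g\<close>. Taking infima over \<open>x\<close> and \<open>y\<close>
  separately, \<open>- conjugate f (- q) - conjugate g q \<ge> v\<close>, so by weak duality \<open>q\<close> solves the dual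
  problem and there is no gap.

  The remaining conditions exclude \<open>r = 0\<close>. In that case \<open>p\<close> is nonnegative on \<open>D = dom f - dom g\<close> without
  vanishing on it. But a nonnegative functional on \<open>D\<close> is nonnegative on the closed cone generated by
  \<open>D\<close>, and if that cone is a subspace (\<open>0 \<in> qi D\<close> or \<open>0 \<in> qri D\<close>), it vanishes there. Under the
  condition on \<open>dom f \<inter> qri (dom g)\<close>, the same argument at a point of that set makes \<open>p\<close> constant on
  \<open>dom g\<close>; so \<open>p\<close> vanishes on \<open>dom g - dom g\<close>, whose generated cone is dense, and \<open>p = 0\<close>.

  The separation theorem comes from the Hahn-Banach theorem in the following form: a sublinear
  functional that is minimal in the pointwise order is linear, and Zorn's lemma supplies
  a minimal one below any given sublinear functional. It is applied to a Minkowski gauge.\<close>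

section \<open>Linear functionals below a sublinear functional\<close>

definition sublinear :: "('a::real_vector \<Rightarrow> real) \<Rightarrow> bool" where
  "sublinear p \<longleftrightarrow> (\<forall>x y. p (x + y) \<le> p x + p y) \<and> (\<forall>t>0. \<forall>x. p (t *\<^sub>R x) \<le> t * p x)"

lemma sublinearI:
  assumes "\<And>x y. p (x + y) \<le> p x + p y" and "\<And>t x. t > 0 \<Longrightarrow> p (t *\<^sub>R x) \<le> t * p x"
  shows "sublinear p"
  using assms by (simp add: sublinear_def)

lemma sublinear_add: "sublinear p \<Longrightarrow> p (x + y) \<le> p x + p y"
  by (simp add: sublinear_def)

lemma sublinear_zero:
  assumes "sublinear p"
  shows "p 0 = 0"
proof -
  have "p (2 *\<^sub>R 0) \<le> 2 * p 0" "p ((1/2) *\<^sub>R 0) \<le> (1/2) * p 0"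
    using assms unfolding sublinear_def by (meson zero_less_numeral zero_less_divide_1_iff)+
  then show ?thesis by simp
qed

lemma sublinear_scale:
  assumes "sublinear p" "t \<ge> 0" shows "p (t *\<^sub>R x) = t * p x"
proof (cases "t = 0")
  case True
  then show ?thesis using sublinear_zero[OF assms(1)] by simp
next
  case False
  with assms have t: "t > 0" by simp
  have "p (inverse t *\<^sub>R (t *\<^sub>R x)) \<le> inverse t * p (t *\<^sub>R x)"
    using assms(1) t unfolding sublinear_def by (meson positive_imp_inverse_positive)
  then have "t * p x \<le> p (t *\<^sub>R x)"
    using t by (simp add: field_simps)
  moreover have "p (t *\<^sub>R x) \<le> t * p x"
    using assms(1) t by (simp add: sublinear_def)
  ultimately show ?thesis by simp
qed

lemma sublinear_minus_le:
  assumes "sublinear p"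
  shows "- p (- x) \<le> p x"
  using sublinear_add[OF assms, of x "- x"] sublinear_zero[OF assms] by simp

lemma le_Inf_add:
  fixes A B :: "real set"
  assumes "A \<noteq> {}" "B \<noteq> {}" "\<And>a b. a \<in> A \<Longrightarrow> b \<in> B \<Longrightarrow> c \<le> a + b"
  shows "c \<le> Inf A + Inf B"
proof -
  have "c - b \<le> Inf A" if "b \<in> B" for b
    using assms that by (intro cInf_greatest) (auto simp: algebra_simps)
  then have "c - Inf A \<le> Inf B"
    using assms(2) by (intro cInf_greatest) (auto simp: algebra_simps)
  then show ?thesis by simp
qed

lemma Inf_scale_le:
  fixes A :: "real set"
  assumes "A \<noteq> {}" "t > 0" "\<And>a. a \<in> A \<Longrightarrow> c \<le> t * a"
  shows "c \<le> t * Inf A"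
proof -
  have "c / t \<le> Inf A"
    using assms by (intro cInf_greatest) (auto simp: field_simps)
  then show ?thesis using assms(2) by (simp add: field_simps)
qed

text \<open>The infimum of \<open>p (x + t y) - t * p y\<close> over \<open>t \<ge> 0\<close> is again sublinear; \<open>t = 0\<close> shows that it lies below
  \<open>p\<close>, and \<open>t = 1\<close> at \<open>x = - y\<close> gives the last bound. It is used twice: a minimal \<open>p\<close>
  must coincide with this infimum, hence be odd, and replacing \<open>p\<close> by it beforehand fixes the value at
  \<open>y\<close> of a linear minorant.\<close>

lemma sublinear_lowered_at_neg:
  fixes p :: "'a::real_vector \<Rightarrow> real"
  assumes p: "sublinear p"
  obtains q where "sublinear q" "\<And>x. q x \<le> p x" "q (- y) \<le> - p y"
proof -
  define S where "S x = (\<lambda>t. p (x + t *\<^sub>R y) - t * p y) ` {0..}" for x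
  define q where "q x = Inf (S x)" for x
  have ne: "S x \<noteq> {}" for x by (auto simp: S_def)
  have bdd: "bdd_below (S x)" for x
  proof (rule bdd_belowI)
    fix s assume "s \<in> S x"
    then obtain t where t: "t \<ge> 0" "s = p (x + t *\<^sub>R y) - t * p y" by (auto simp: S_def)
    then show "- p (- x) \<le> s"
      using sublinear_add[OF p, of "- x" "x + t *\<^sub>R y"] sublinear_scale[OF p, of t y] by simp
  qed
  have le: "q x \<le> p (x + t *\<^sub>R y) - t * p y" if "t \<ge> 0" for x t
    unfolding q_def using bdd that by (intro cInf_lower) (auto simp: S_def)
  show ?thesis
  proof
    show "sublinear q"
    proof (rule sublinearI)
      fix x x'
      show "q (x + x') \<le> q x + q x'"
        unfolding q_def[of x] q_def[of x']
      proof (rule le_Inf_add[OF ne ne])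
        fix a b assume "a \<in> S x" "b \<in> S x'"
        then obtain t t' where t: "t \<ge> 0" "t' \<ge> 0"
          and a: "a = p (x + t *\<^sub>R y) - t * p y" and b: "b = p (x' + t' *\<^sub>R y) - t' * p y"
          by (auto simp: S_def)
        have "q (x + x') \<le> p ((x + x') + (t + t') *\<^sub>R y) - (t + t') * p y"
          using t by (intro le) auto
        also have "(x + x') + (t + t') *\<^sub>R y = (x + t *\<^sub>R y) + (x' + t' *\<^sub>R y)"
          by (simp add: algebra_simps)
        finally show "q (x + x') \<le> a + b"
          using sublinear_add[OF p, of "x + t *\<^sub>R y" "x' + t' *\<^sub>R y"] a b
          by (simp add: algebra_simps)
      qed
    next
      fix s :: real and x assume s: "s > 0"
      show "q (s *\<^sub>R x) \<le> s * q x"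
        unfolding q_def[of x]
      proof (rule Inf_scale_le[OF ne s])
        fix a assume "a \<in> S x"
        then obtain t where t: "t \<ge> 0" and a: "a = p (x + t *\<^sub>R y) - t * p y"
          by (auto simp: S_def)
        have "q (s *\<^sub>R x) \<le> p (s *\<^sub>R x + (s * t) *\<^sub>R y) - (s * t) * p y"
          using s t by (intro le) auto
        also have "s *\<^sub>R x + (s * t) *\<^sub>R y = s *\<^sub>R (x + t *\<^sub>R y)"
          by (simp add: algebra_simps)
        finally show "q (s *\<^sub>R x) \<le> s * a"
          using sublinear_scale[OF p, of s "x + t *\<^sub>R y"] s a by (simp add: right_diff_distrib)
      qed
    qed
    show "q x \<le> p x" for x using le[of 0 x] by simp
    show "q (- y) \<le> - p y" using le[of 1 "- y"] sublinear_zero[OF p] by simp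
  qed
qed

text \<open>Along a chain the pointwise infimum is sublinear, because any two members have a common lower
  bound among the two of them; and it is finite, because every sublinear \<open>q \<le> p\<close> satisfies
  \<open>q x \<ge> - p (- x)\<close>.\<close>

lemma minimal_sublinear_below:
  fixes p :: "'a::real_vector \<Rightarrow> real"
  assumes p: "sublinear p"
  obtains m where "sublinear m" "m \<le> p" "\<And>q. sublinear q \<Longrightarrow> q \<le> m \<Longrightarrow> q = m"
proof -
  define A where "A = {q. sublinear q \<and> q \<le> p}"
  have "\<exists>m\<in>A. \<forall>a\<in>A. a \<le> m \<longrightarrow> a = m"
  proof (rule predicate_Zorn)
    \<comment> \<open>The order is reversed, so that a maximal element is a minimal functional.\<close>
    show "partial_order_on A (relation_of (\<lambda>q r. r \<le> q) A)"
      by (rule partial_order_on_relation_ofI) auto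
  next
    fix C assume "C \<in> Chains (relation_of (\<lambda>q r. r \<le> q) A)"
    then have CA: "C \<subseteq> A" and chain: "\<And>q r. q \<in> C \<Longrightarrow> r \<in> C \<Longrightarrow> q \<le> r \<or> r \<le> q"
      unfolding Chains_def relation_of_def by auto
    show "\<exists>u\<in>A. \<forall>a\<in>C. u \<le> a"
    proof (cases "C = {}")
      case True
      then show ?thesis using p by (auto simp: A_def)
    next
      case False
      define S where "S x = (\<lambda>q. q x) ` C" for x
      define u where "u x = Inf (S x)" for x
      have ne: "S x \<noteq> {}" for x using False by (simp add: S_def)
      have bdd: "bdd_below (S x)" for x
      proof (rule bdd_belowI)
        fix s assume "s \<in> S x"
        then obtain q where "q \<in> C" "s = q x" by (auto simp: S_def)
        with CA have "sublinear q" "q (- x) \<le> p (- x)" by (auto simp: A_def le_fun_def)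
        then show "- p (- x) \<le> s"
          using sublinear_minus_le[of q x] \<open>s = q x\<close> by simp
      qed
      have le: "u x \<le> q x" if "q \<in> C" for q x
        unfolding u_def using bdd that by (intro cInf_lower) (auto simp: S_def)
      have "sublinear u"
      proof (rule sublinearI)
        fix x y
        show "u (x + y) \<le> u x + u y"
          unfolding u_def[of x] u_def[of y]
        proof (rule le_Inf_add[OF ne ne])
          fix a b assume "a \<in> S x" "b \<in> S y"
          then obtain q r where qr: "q \<in> C" "r \<in> C" "a = q x" "b = r y" by (auto simp: S_def)
          obtain s where s: "s \<in> C" "s \<le> q" "s \<le> r" using chain qr by blast
          then have "u (x + y) \<le> s (x + y)" by (intro le)
          also have "\<dots> \<le> s x + s y" using s CA by (intro sublinear_add) (auto simp: A_def)
          also have "\<dots> \<le> a + b" using s qr by (intro add_mono) (auto simp: le_fun_def)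
          finally show "u (x + y) \<le> a + b" .
        qed
      next
        fix t :: real and x assume t: "t > 0"
        show "u (t *\<^sub>R x) \<le> t * u x"
          unfolding u_def[of x]
        proof (rule Inf_scale_le[OF ne t])
          fix a assume "a \<in> S x"
          then obtain q where q: "q \<in> C" "a = q x" by (auto simp: S_def)
          then show "u (t *\<^sub>R x) \<le> t * a"
            using le[OF q(1), of "t *\<^sub>R x"] sublinear_scale[of q t x] CA t by (auto simp: A_def)
        qed
      qed
      moreover have "u \<le> p"
      proof -
        obtain q where "q \<in> C" using False by blast
        then have "u \<le> q" "q \<le> p" using le CA by (auto simp: A_def le_fun_def)
        then show ?thesis by (rule order_trans)
      qed
      ultimately show ?thesis using le by (auto simp: A_def le_fun_def)
    qed
  qed
  then obtain m where m: "m \<in> A" "\<And>a. a \<in> A \<Longrightarrow> a \<le> m \<Longrightarrow> a = m" by blast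
  show ?thesis
  proof
    show "sublinear m" "m \<le> p" using m by (auto simp: A_def)
    fix q assume "sublinear q" "q \<le> m"
    moreover from this have "q \<le> p" using \<open>m \<le> p\<close> by (meson order_trans)
    ultimately show "q = m" using m by (auto simp: A_def)
  qed
qed

text \<open>The Hahn-Banach theorem with the value at one point prescribed. A minimal sublinear functional
  is odd, and an odd subadditive function is additive.\<close>

lemma linear_below_sublinear:
  fixes p :: "'a::real_vector \<Rightarrow> real"
  assumes p: "sublinear p"
  obtains L where "linear L" "\<And>x. L x \<le> p x" "L y = p y"
proof -
  obtain p' where p': "sublinear p'" "\<And>x. p' x \<le> p x" "p' (- y) \<le> - p y"
    using sublinear_lowered_at_neg[OF p, of y] by metis
  obtain L where L: "sublinear L" "L \<le> p'" and min: "\<And>q. sublinear q \<Longrightarrow> q \<le> L \<Longrightarrow> q = L"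
    using minimal_sublinear_below[OF p'(1)] by blast
  \<comment> \<open>Minimality: lowering \<open>L\<close> at \<open>- x\<close> changes nothing.\<close>
  have minus: "L (- x) = - L x" for x
  proof -
    obtain q where q: "sublinear q" "\<And>z. q z \<le> L z" "q (- x) \<le> - L x"
      using sublinear_lowered_at_neg[OF L(1), of x] by metis
    then have "q = L" by (intro min) (auto simp: le_fun_def)
    then show ?thesis using q(3) sublinear_minus_le[OF L(1), of x] by simp
  qed
  have add: "L (x + z) = L x + L z" for x z
    using sublinear_add[OF L(1), of x z] sublinear_add[OF L(1), of "x + z" "- z"] minus[of z]
    by simp
  have scale: "L (c *\<^sub>R x) = c * L x" for c x
  proof (cases "c \<ge> 0")
    case False
    have "L (c *\<^sub>R x) = - L ((- c) *\<^sub>R x)" using minus[of "(- c) *\<^sub>R x"] by simp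
    then show ?thesis using sublinear_scale[OF L(1), of "- c" x] False by simp
  qed (use sublinear_scale[OF L(1)] in auto)
  show ?thesis
  proof
    show "linear L" using add scale by (intro linearI) auto
    show le: "L x \<le> p x" for x using L(2) p'(2)[of x] by (meson le_funD order_trans)
    have "L (- y) \<le> - p y" using L(2) p'(3) by (meson le_funD order_trans)
    then show "L y = p y" using minus[of y] le[of y] by simp
  qed
qed

section \<open>Separating a point from a closed convex cone\<close>

lemma tendsto_scaleR_lcs:
  fixes g :: "'b \<Rightarrow> 'a::locally_convex_space"
  assumes "(f \<longlongrightarrow> c) F" "(g \<longlongrightarrow> x) F"
  shows "((\<lambda>z. f z *\<^sub>R g z) \<longlongrightarrow> c *\<^sub>R x) F"
  using filterlim_compose[OF tendsto_scaleR_Pair filterlim_Pair[OF assms]] by simp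

lemma continuous_on_scaleR_lcs:
  fixes g :: "'b::topological_space \<Rightarrow> 'a::locally_convex_space"
  assumes "continuous_on S f" "continuous_on S g"
  shows "continuous_on S (\<lambda>z. f z *\<^sub>R g z)"
  using assms by (auto simp: continuous_on_def intro: tendsto_scaleR_lcs)

text \<open>The separation takes place in \<open>X \<times> \<real>\<close>, so products of topological groups, and then of locally convex
  spaces, are shown to be of the same kind.\<close>

instance prod :: (topological_monoid_add, topological_monoid_add) topological_monoid_add
proof
  fix a b :: "'a \<times> 'b"
  have "((\<lambda>z. (fst (fst z) + fst (snd z), snd (fst z) + snd (snd z))) \<longlongrightarrow>
          (fst a + fst b, snd a + snd b)) (nhds a \<times>\<^sub>F nhds b)"
    by (intro tendsto_Pair tendsto_add tendsto_fst tendsto_snd)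
      (auto intro: filterlim_fst filterlim_snd)
  then show "((\<lambda>z. fst z + snd z) \<longlongrightarrow> a + b) (nhds a \<times>\<^sub>F nhds b)"
    by (simp add: plus_prod_def)
qed

instance prod :: (topological_comm_monoid_add, topological_comm_monoid_add)
  topological_comm_monoid_add ..

instance prod :: (topological_group_add, topological_group_add) topological_group_add
proof
  fix a :: "'a \<times> 'b"
  have "((\<lambda>z. (- fst z, - snd z)) \<longlongrightarrow> (- fst a, - snd a)) (nhds a)"
    by (intro tendsto_Pair tendsto_minus tendsto_fst tendsto_snd filterlim_ident)
  then show "(uminus \<longlongrightarrow> - a) (nhds a)"
    by (simp add: uminus_prod_def[abs_def])
qed

instance prod :: (topological_ab_group_add, topological_ab_group_add)
  topological_ab_group_add ..

instance prod :: (locally_convex_space, locally_convex_space) locally_convex_space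
proof
  fix c :: real and x :: "'a \<times> 'b"
  have fs: "(fst \<longlongrightarrow> c) (nhds c \<times>\<^sub>F nhds x)" "(snd \<longlongrightarrow> x) (nhds c \<times>\<^sub>F nhds x)"
    by (auto intro: filterlim_fst filterlim_snd)
  have "LIM z (nhds c \<times>\<^sub>F nhds x). (fst z *\<^sub>R fst (snd z), fst z *\<^sub>R snd (snd z))
          :> nhds (c *\<^sub>R fst x, c *\<^sub>R snd x)"
    by (intro tendsto_Pair tendsto_scaleR_lcs tendsto_fst tendsto_snd fs)
  then show "LIM z (nhds c \<times>\<^sub>F nhds x). fst z *\<^sub>R snd z :> nhds (c *\<^sub>R x)"
    by (simp add: scaleR_prod_def)
next
  fix U :: "('a \<times> 'b) set"
  assume "open U" "0 \<in> U"
  then obtain A B where AB: "open A" "open B" "0 \<in> A" "0 \<in> B" "A \<times> B \<subseteq> U"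
    by (metis open_prod_elim mem_Sigma_iff zero_prod_def)
  obtain A' where A': "open A'" "convex A'" "0 \<in> A'" "A' \<subseteq> A"
    using ex_convex_open_nhd_zero'[OF AB(1,3)] by blast
  obtain B' where B': "open B'" "convex B'" "0 \<in> B'" "B' \<subseteq> B"
    using ex_convex_open_nhd_zero'[OF AB(2,4)] by blast
  have "open (A' \<times> B')" "convex (A' \<times> B')" "0 \<in> A' \<times> B'" "A' \<times> B' \<subseteq> U"
    using A' B' AB(5) by (auto simp: open_Times convex_Times zero_prod_def)
  then show "\<exists>C. open C \<and> 0 \<in> C \<and> C \<subseteq> U \<and>
       (\<forall>x\<in>C. \<forall>y\<in>C. \<forall>u\<ge>0. \<forall>v\<ge>0. u + v = 1 \<longrightarrow> u *\<^sub>R x + v *\<^sub>R y \<in> C)"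
    unfolding convex_def by (intro exI[of _ "A' \<times> B'"] conjI)
qed

lemma open_nhd_zero_absorbing:
  fixes C :: "'a::locally_convex_space set"
  assumes "open C" "0 \<in> C"
  obtains t c where "t > 0" "c \<in> C" "x = t *\<^sub>R c"
proof -
  have "((\<lambda>s::real. s *\<^sub>R x) \<longlongrightarrow> 0 *\<^sub>R x) (at_right 0)"
    by (intro tendsto_scaleR_lcs tendsto_ident_at tendsto_const)
  then have "eventually (\<lambda>s::real. s *\<^sub>R x \<in> C) (at_right 0)"
    using assms by (intro topological_tendstoD) auto
  moreover have "eventually (\<lambda>s::real. s > 0) (at_right 0)"
    by (rule eventually_at_right_less)
  ultimately have "eventually (\<lambda>s::real. s > 0 \<and> s *\<^sub>R x \<in> C) (at_right 0)"
    by eventually_elim auto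
  then obtain s :: real where "s > 0" "s *\<^sub>R x \<in> C"
    using eventually_happens' trivial_limit_at_right_real by blast
  then show ?thesis using that[of "inverse s" "s *\<^sub>R x"] by simp
qed

text \<open>On the symmetric neighbourhood \<open>C \<inter> - C\<close> the bound is two-sided, and rescaling it by \<open>e / 2\<close> gives
  the estimate needed at each point.\<close>

lemma linear_bounded_above_continuous:
  fixes L :: "'a::locally_convex_space \<Rightarrow> real"
  assumes L: "linear L" and C: "open C" "0 \<in> C" and bd: "\<And>x. x \<in> C \<Longrightarrow> L x \<le> 1"
  shows "continuous_on UNIV L"
proof -
  have "(L \<longlongrightarrow> L x) (nhds x)" for x
  proof (rule tendstoI)
    fix e :: real assume e: "e > 0"
    define U where "U = (\<lambda>y. (2 / e) *\<^sub>R (y - x)) -` C \<inter> (\<lambda>y. (2 / e) *\<^sub>R (x - y)) -` C"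
    have "open U" unfolding U_def
      by (intro open_Int open_vimage C continuous_on_scaleR_lcs continuous_intros)
    moreover have "x \<in> U" using C by (simp add: U_def)
    moreover have "dist (L y) (L x) < e" if "y \<in> U" for y
    proof -
      have "L ((2 / e) *\<^sub>R (y - x)) \<le> 1" "L ((2 / e) *\<^sub>R (x - y)) \<le> 1"
        using that bd by (auto simp: U_def)
      then have "(2 / e) * (L y - L x) \<le> 1" "(2 / e) * (L x - L y) \<le> 1"
        unfolding linear_scale[OF L] linear_diff[OF L] real_scaleR_def .
      moreover have "d \<le> e / 2" if "(2 / e) * d \<le> 1" for d
        using that e by (simp add: field_simps)
      ultimately have "L y - L x \<le> e / 2" "L x - L y \<le> e / 2" by blast+
      then show ?thesis using e by (simp add: dist_real_def abs_if)
    qed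
    ultimately show "eventually (\<lambda>y. dist (L y) (L x) < e) (nhds x)"
      unfolding eventually_nhds by blast
  qed
  then show ?thesis
    by (auto simp: continuous_on_def at_within_def intro: tendsto_mono[OF inf_le1])
qed

text \<open>Take a convex neighbourhood \<open>C\<close> of \<open>0\<close> with \<open>C - z\<close> disjoint from \<open>K\<close>, and let \<open>p\<close> be the gauge of \<open>C - K\<close>.
  It is at most \<open>1\<close> on \<open>C\<close>, nonpositive on \<open>- K\<close>, and at least \<open>1\<close> at \<open>z\<close> by disjointness. A linear \<open>L \<le> p\<close>
  with \<open>L z = p z\<close> is therefore continuous, nonnegative on \<open>K\<close> and positive at \<open>z\<close>.\<close>

lemma separation_closed_convex_cone:
  fixes K :: "'a::locally_convex_space set"
  assumes K: "closed K" "0 \<in> K" "\<And>x y. x \<in> K \<Longrightarrow> y \<in> K \<Longrightarrow> x + y \<in> K"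
    "\<And>t x. t \<ge> 0 \<Longrightarrow> x \<in> K \<Longrightarrow> t *\<^sub>R x \<in> K"
    and z: "- z \<notin> K"
  obtains L where "L \<in> topological_dual" "\<And>x. x \<in> K \<Longrightarrow> L x \<ge> 0" "L z > 0"
proof -
  have "open ((\<lambda>c. c - z) -` (- K))"
    using K(1) by (intro open_vimage continuous_intros) auto
  then obtain C where C: "open C" "convex C" "0 \<in> C" "C \<subseteq> (\<lambda>c. c - z) -` (- K)"
    using ex_convex_open_nhd_zero'[of "(\<lambda>c. c - z) -` (- K)"] z by auto
  define S where "S x = {t. t > 0 \<and> (\<exists>k\<in>K. \<exists>c\<in>C. x + k = t *\<^sub>R c)}" for x
  define p where "p x = Inf (S x)" for x
  have ne: "S x \<noteq> {}" for x
  proof -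
    obtain t c where "t > 0" "c \<in> C" "x = t *\<^sub>R c"
      using open_nhd_zero_absorbing[OF C(1,3)] by blast
    moreover from this have "x + 0 = t *\<^sub>R c" by simp
    ultimately have "t \<in> S x" using K(2) unfolding S_def by blast
    then show ?thesis by blast
  qed
  have bdd: "bdd_below (S x)" for x
    by (rule bdd_belowI[of _ 0]) (auto simp: S_def)
  have le: "p x \<le> t" if "t > 0" "k \<in> K" "c \<in> C" "x + k = t *\<^sub>R c" for x t k c
    unfolding p_def using bdd that by (intro cInf_lower) (auto simp: S_def)
  have p: "sublinear p"
  proof (rule sublinearI)
    fix x y
    show "p (x + y) \<le> p x + p y"
      unfolding p_def[of x] p_def[of y]
    proof (rule le_Inf_add[OF ne ne])
      fix a b assume "a \<in> S x" "b \<in> S y"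
      then obtain k c l d where a: "a > 0" "k \<in> K" "c \<in> C" "x + k = a *\<^sub>R c"
        and b: "b > 0" "l \<in> K" "d \<in> C" "y + l = b *\<^sub>R d" by (auto simp: S_def)
      define e where "e = (a / (a + b)) *\<^sub>R c + (b / (a + b)) *\<^sub>R d"
      have "e \<in> C" unfolding e_def using a b C(2)
        by (intro convexD) (auto simp flip: add_divide_distrib)
      moreover have "(x + y) + (k + l) = (a + b) *\<^sub>R e"
      proof -
        have "(a + b) *\<^sub>R e = a *\<^sub>R c + b *\<^sub>R d"
          using a b by (simp add: e_def scaleR_right_distrib)
        then show ?thesis using a b by (simp add: algebra_simps)
      qed
      ultimately show "p (x + y) \<le> a + b" using a b K(3) by (intro le[of _ "k + l" e]) auto
    qed
  next
    fix s :: real and x assume s: "s > 0"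
    show "p (s *\<^sub>R x) \<le> s * p x"
      unfolding p_def[of x]
    proof (rule Inf_scale_le[OF ne s])
      fix a assume "a \<in> S x"
      then obtain k c where a: "a > 0" "k \<in> K" "c \<in> C" "x + k = a *\<^sub>R c" by (auto simp: S_def)
      have "s *\<^sub>R x + s *\<^sub>R k = (s * a) *\<^sub>R c" using a(4) by (metis scaleR_right_distrib scaleR_scaleR)
      then show "p (s *\<^sub>R x) \<le> s * a" using a s K(4) by (intro le[of _ "s *\<^sub>R k" c]) auto
    qed
  qed
  obtain L where L: "linear L" "\<And>x. L x \<le> p x" "L z = p z"
    using linear_below_sublinear[OF p] by blast
  have "L x \<le> 1" if "x \<in> C" for x
    using L(2)[of x] le[of 1 0 x x] K(2) that by simp
  then have "continuous_on UNIV L"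
    by (intro linear_bounded_above_continuous[OF L(1) C(1,3)])
  then have "L \<in> topological_dual" using L(1) by (simp add: topological_dual_def)
  moreover have "L x \<ge> 0" if "x \<in> K" for x
  proof -
    have "p (- x) \<le> 0"
    proof (rule field_le_epsilon)
      fix e :: real assume "e > 0"
      then show "p (- x) \<le> 0 + e" using le[of e x 0 "- x"] that C(3) by simp
    qed
    then show ?thesis using L(2)[of "- x"] linear_neg[OF L(1), of x] by simp
  qed
  moreover have "L z > 0"
  proof -
    have "1 \<le> t" if "t \<in> S z" for t
    proof (rule ccontr)
      assume "\<not> 1 \<le> t"
      with that obtain k c where t: "0 < t" "t < 1" "k \<in> K" "c \<in> C" "z + k = t *\<^sub>R c"
        by (auto simp: S_def)
      have "t *\<^sub>R c + (1 - t) *\<^sub>R 0 \<in> C" using t C by (intro convexD) auto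
      then have "t *\<^sub>R c - z \<notin> K" using C(4) by auto
      moreover have "t *\<^sub>R c - z = k" using t(5) by (simp add: algebra_simps)
      ultimately show False using t(3) by simp
    qed
    then have "1 \<le> p z" unfolding p_def by (intro cInf_greatest[OF ne])
    then show ?thesis using L(3) by simp
  qed
  ultimately show ?thesis using that by blast
qed

section \<open>Cones generated by sets and the quasi-relative interior\<close>

lemma generated_cone_superset: "U \<subseteq> generated_cone U"
  by (force simp: generated_cone_def intro: bexI[of _ 1])

lemma generated_cone_scale:
  assumes "x \<in> generated_cone U" "t \<ge> 0" shows "t *\<^sub>R x \<in> generated_cone U"
proof -
  obtain s u where "s \<ge> 0" "u \<in> U" "x = s *\<^sub>R u"
    using assms(1) by (auto simp: generated_cone_def)
  then show ?thesis using assms(2)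
    by (auto simp: generated_cone_def intro!: bexI[of _ "t * s"])
qed

lemma generated_cone_add:
  assumes "convex U" "x \<in> generated_cone U" "y \<in> generated_cone U"
  shows "x + y \<in> generated_cone U"
proof -
  obtain s u where s: "s \<ge> 0" "u \<in> U" "x = s *\<^sub>R u"
    using assms(2) by (auto simp: generated_cone_def)
  obtain t v where t: "t \<ge> 0" "v \<in> U" "y = t *\<^sub>R v"
    using assms(3) by (auto simp: generated_cone_def)
  show ?thesis
  proof (cases "s + t = 0")
    case True
    then have "s = 0" "t = 0" using s t by auto
    then show ?thesis using s t by (auto simp: generated_cone_def intro!: bexI[of _ 0])
  next
    case False
    then have pos: "s + t > 0" using s t by simp
    define w where "w = (s / (s + t)) *\<^sub>R u + (t / (s + t)) *\<^sub>R v"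
    have "w \<in> U" unfolding w_def using s t pos assms(1)
      by (intro convexD) (auto simp flip: add_divide_distrib)
    moreover have "x + y = (s + t) *\<^sub>R w"
      using s t pos by (simp add: w_def scaleR_right_distrib)
    ultimately show ?thesis using pos by (auto simp: generated_cone_def intro!: bexI[of _ "s + t"])
  qed
qed

lemma closure_scale_closed:
  fixes K :: "'a::locally_convex_space set"
  assumes "\<And>x. x \<in> K \<Longrightarrow> t *\<^sub>R x \<in> K" "x \<in> closure K"
  shows "t *\<^sub>R x \<in> closure K"
proof -
  have "(\<lambda>x. t *\<^sub>R x) ` closure K \<subseteq> closure K"
    using assms(1) closure_subset
    by (intro image_closure_subset continuous_on_scaleR_lcs continuous_intros) auto
  then show ?thesis using assms(2) by blast
qed

text \<open>The closure is taken in one summand at a time, using only separate continuity of addition.\<close>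

lemma closure_add_closed:
  fixes K :: "'a::topological_ab_group_add set"
  assumes K: "\<And>x y. x \<in> K \<Longrightarrow> y \<in> K \<Longrightarrow> x + y \<in> K" and xy: "x \<in> closure K" "y \<in> closure K"
  shows "x + y \<in> closure K"
proof -
  have "(\<lambda>x. x + y) ` closure K \<subseteq> closure K" if "y \<in> K" for y
    using K that closure_subset by (intro image_closure_subset continuous_intros) auto
  then have "(\<lambda>y. x + y) ` closure K \<subseteq> closure K"
    using xy(1) by (intro image_closure_subset continuous_intros) auto
  then show ?thesis using xy(2) by blast
qed

lemma dual_nonneg_closure_cone:
  assumes L: "L \<in> topological_dual" "\<And>u. u \<in> U \<Longrightarrow> L u \<ge> 0"
    and x: "x \<in> closure (generated_cone U)"
  shows "L x \<ge> 0"
proof -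
  have "closed (L -` {0..})"
    using L(1) by (intro closed_vimage) (auto simp: topological_dual_def)
  moreover have "generated_cone U \<subseteq> L -` {0..}"
    using L by (auto simp: generated_cone_def topological_dual_def linear_scale)
  ultimately show ?thesis using x closure_minimal by blast
qed

lemma dual_vanishes_of_subspace:
  assumes L: "L \<in> topological_dual" "\<And>u. u \<in> U \<Longrightarrow> L u \<ge> 0"
    and sub: "subspace (closure (generated_cone U))" and u: "u \<in> U"
  shows "L u = 0"
proof -
  have "u \<in> closure (generated_cone U)"
    using u generated_cone_superset closure_subset by blast
  then have "- u \<in> closure (generated_cone U)" using sub by (rule subspace_neg[rotated])
  then have "L (- u) \<ge> 0" using dual_nonneg_closure_cone[OF L] by blast
  then show ?thesis using L u by (auto simp: topological_dual_def linear_neg intro: antisym)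
qed

text \<open>The separated point is \<open>- z\<close>, where \<open>z\<close> lies in the closed cone generated by \<open>U\<close> and \<open>- z\<close> does not. This
  makes the functional positive somewhere on \<open>U\<close>: otherwise it would be nonpositive on that whole cone, in
  particular at \<open>z\<close>.\<close>

lemma proper_separation_of_not_qri:
  fixes U :: "'a::locally_convex_space set"
  assumes "convex U" "0 \<in> U" "0 \<notin> qri U"
  obtains L u where "L \<in> topological_dual" "\<And>x. x \<in> U \<Longrightarrow> L x \<ge> 0" "u \<in> U" "L u > 0"
proof -
  define K where "K = closure (generated_cone U)"
  have UK: "U \<subseteq> K" unfolding K_def using generated_cone_superset closure_subset by blast
  then have zero: "0 \<in> K" using assms(2) by blast
  have add: "x + y \<in> K" if "x \<in> K" "y \<in> K" for x y
    using that unfolding K_def by (intro closure_add_closed generated_cone_add assms(1))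
  have scale: "t *\<^sub>R x \<in> K" if "t \<ge> 0" "x \<in> K" for t x
    using that unfolding K_def by (intro closure_scale_closed generated_cone_scale)
  have "\<not> subspace K" using assms(2,3) by (simp add: qri_def K_def)
  then obtain z where z: "z \<in> K" "- z \<notin> K"
  proof -
    have "subspace K" if neg: "\<And>z. z \<in> K \<Longrightarrow> - z \<in> K"
    proof (rule subspaceI)
      fix c x assume x: "x \<in> K"
      show "c *\<^sub>R x \<in> K"
      proof (cases "c \<ge> 0")
        case False
        then show ?thesis using neg[OF scale[of "- c" x]] x by simp
      qed (use scale x in auto)
    qed (use zero add in auto)
    then show ?thesis using that \<open>\<not> subspace K\<close> by blast
  qed
  obtain L where L: "L \<in> topological_dual" "\<And>x. x \<in> K \<Longrightarrow> L x \<ge> 0" "L z > 0"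
    using separation_closed_convex_cone[OF _ zero add scale z(2)] unfolding K_def by auto
  have "\<exists>u\<in>U. L u > 0"
  proof (rule ccontr)
    assume "\<not> ?thesis"
    then have "L u \<le> 0" if "u \<in> U" for u using that by force
    then have "\<And>u. u \<in> U \<Longrightarrow> - L u \<ge> 0" by simp
    moreover have "(\<lambda>x. - L x) \<in> topological_dual"
      using L(1) by (auto simp: topological_dual_def intro: linear_compose_neg continuous_on_minus)
    ultimately have "- L z \<ge> 0"
      using dual_nonneg_closure_cone[of "\<lambda>x. - L x" U z] z(1) by (auto simp: K_def)
    then show False using L(3) by simp
  qed
  then show ?thesis using that L(1,2) UK by blast
qed

section \<open>Fenchel duality\<close>

lemma weak_duality:
  assumes "proper f" "proper g"
  shows "dual_objective f g y \<le> primal_value f g"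
  unfolding primal_value_def
proof (rule INF_greatest)
  fix x
  have cf: "ereal (- y x) - f x \<le> conjugate f (\<lambda>x. - y x)"
    unfolding conjugate_def by (rule SUP_upper) simp
  have cg: "ereal (y x) - g x \<le> conjugate g y"
    unfolding conjugate_def by (rule SUP_upper) simp
  have arith: "- A - B \<le> F + G"
    if "ereal (- c) - F \<le> A" "ereal c - G \<le> B" "F \<noteq> - \<infinity>" "G \<noteq> - \<infinity>" for A B F G :: ereal and c
    using that by (cases F; cases G; cases A; cases B) auto
  have "f x \<noteq> - \<infinity>" "g x \<noteq> - \<infinity>" using assms by (auto simp: proper_def)
  then show "dual_objective f g y \<le> f x + g x"
    unfolding dual_objective_def by (rule arith[OF cf cg])
qed

text \<open>The inequality couples \<open>x\<close> and \<open>y\<close> only through a sum, so the suprema in the two conjugates can be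
  taken one after the other. Nonempty domains make \<open>conjugate g q\<close> finite, which allows it to be
  moved to the other side.\<close>

lemma dual_objective_ge:
  fixes v :: real
  assumes f: "proper f" and g: "proper g"
    and ineq: "\<And>x y. x \<in> edom f \<Longrightarrow> y \<in> edom g \<Longrightarrow>
      q x - q y + real_of_ereal (f x) + real_of_ereal (g y) - v \<ge> 0"
  shows "dual_objective f g q \<ge> ereal v"
proof -
  have fin: "\<exists>a. h x = ereal a" if "proper h" "x \<in> edom h" for h and x :: 'a
    using that by (cases "h x") (auto simp: proper_def edom_def)
  obtain y0 where "y0 \<in> edom g" using g by (auto simp: proper_def)
  then obtain b where b: "g y0 = ereal b" using fin[OF g] by blast
  have bnd: "conjugate g q \<le> ereal (q x + real_of_ereal (f x) - v)" if x: "x \<in> edom f" for x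
    unfolding conjugate_def
  proof (rule SUP_least)
    fix y
    show "ereal (q y) - g y \<le> ereal (q x + real_of_ereal (f x) - v)"
    proof (cases "y \<in> edom g")
      case True
      then obtain c where "g y = ereal c" using fin[OF g] by blast
      then show ?thesis using ineq[OF x True] by simp
    qed (simp add: edom_def)
  qed
  obtain x0 where "x0 \<in> edom f" using f by (auto simp: proper_def)
  note bnd0 = bnd[OF this]
  have "ereal (q y0) - g y0 \<le> conjugate g q"
    unfolding conjugate_def by (rule SUP_upper) simp
  then obtain c where c: "conjugate g q = ereal c"
    using bnd0 b by (cases "conjugate g q") auto
  have "conjugate f (\<lambda>x. - q x) \<le> ereal (- v - c)"
    unfolding conjugate_def
  proof (rule SUP_least)
    fix x
    show "ereal (- q x) - f x \<le> ereal (- v - c)"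
    proof (cases "x \<in> edom f")
      case True
      then obtain a where "f x = ereal a" using fin[OF f] by blast
      then show ?thesis using bnd[OF True] c by simp
    qed (simp add: edom_def)
  qed
  then show ?thesis unfolding dual_objective_def c
    by (cases "conjugate f (\<lambda>x. - q x)") auto
qed

lemma strong_duality_of_functional:
  fixes f g :: "'a::locally_convex_space \<Rightarrow> ereal"
  assumes f: "proper f" and g: "proper g" and q: "q \<in> topological_dual"
    and ge: "dual_objective f g q \<ge> primal_value f g"
  shows "primal_value f g = dual_value f g \<and> dual_optimal_solution f g q"
proof -
  have eq: "dual_objective f g q = primal_value f g"
    using weak_duality[OF f g] ge by (rule antisym)
  have "dual_value f g = primal_value f g"
    unfolding dual_value_def
    by (rule antisym) (auto intro: SUP_least weak_duality[OF f g] SUP_upper2[OF q] ge)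
  then show ?thesis using eq q by (simp add: dual_optimal_solution_def)
qed

text \<open>The part of the argument shared by all regularity conditions. The last hypothesis is what each
  of them has to provide: no vertical hyperplane, given by \<open>p\<close> alone, separates \<open>(0, 0)\<close> properly from
  \<open>E_F\<close>.\<close>

lemma strong_duality_of_nonvertical_separation:
  fixes f g :: "'a::locally_convex_space \<Rightarrow> ereal"
  assumes f: "proper f" and g: "proper g" and fin: "\<bar>primal_value f g\<bar> \<noteq> \<infinity>"
    and nqri: "(0, 0) \<notin> qri (convex hull (E_F f g \<union> {(0, 0)}))"
    and nonvert: "\<And>p. p \<in> topological_dual \<Longrightarrow>
      (\<And>x y. x \<in> edom f \<Longrightarrow> y \<in> edom g \<Longrightarrow> p (x - y) \<ge> 0) \<Longrightarrow>
      (\<And>x y. x \<in> edom f \<Longrightarrow> y \<in> edom g \<Longrightarrow> p (x - y) = 0)"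
  shows "primal_value f g = dual_value f g \<and> (\<exists>y. dual_optimal_solution f g y)"
proof -
  obtain v where v: "primal_value f g = ereal v" using fin by auto
  note E = E_F_eq[OF f g v]
  let ?U = "convex hull (E_F f g \<union> {(0, 0)})"
  have sub: "E_F f g \<union> {(0, 0)} \<subseteq> ?U" by (rule hull_subset)
  obtain L u where L: "L \<in> topological_dual" "\<And>x. x \<in> ?U \<Longrightarrow> L x \<ge> 0" and u: "u \<in> ?U" "L u > 0"
    using proper_separation_of_not_qri[OF convex_convex_hull, of "E_F f g \<union> {(0, 0)}"] sub nqri
    by (auto simp: zero_prod_def)
  have lin: "linear L" and cont: "continuous_on UNIV L"
    using L(1) by (auto simp: topological_dual_def)
  define p where "p x = L (x, 0)" for x
  define r where "r = L (0, 1)"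
  have Lpr: "L (x, s) = p x + r * s" for x s
  proof -
    have "L (x, s) = L ((x, 0) + s *\<^sub>R (0, 1))" by simp
    also have "\<dots> = p x + s * r" unfolding p_def r_def
      by (simp only: linear_add[OF lin] linear_scale[OF lin] real_scaleR_def)
    finally show ?thesis by simp
  qed
  have plin: "linear p"
  proof (rule linearI)
    show "p (x + y) = p x + p y" for x y
      using linear_add[OF lin, of "(x, 0)" "(y, 0)"] by (simp add: p_def)
    show "p (c *\<^sub>R x) = c *\<^sub>R p x" for c x
      using linear_scale[OF lin, of c "(x, 0)"] by (simp add: p_def)
  qed
  have "continuous_on UNIV p" unfolding p_def
    by (rule continuous_on_compose2[OF cont]) (auto intro!: continuous_intros)
  then have pdual: "p \<in> topological_dual" using plin by (simp add: topological_dual_def)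
  define h where "h x y = real_of_ereal (f x) + real_of_ereal (g y) - v" for x y
  have inE: "(x - y, h x y + e) \<in> E_F f g" if "x \<in> edom f" "y \<in> edom g" "e \<ge> 0" for x y e
    using that unfolding E h_def by blast
  have nonneg: "p (x - y) + r * (h x y + e) \<ge> 0" if "x \<in> edom f" "y \<in> edom g" "e \<ge> 0" for x y e
    using L(2)[of "(x - y, h x y + e)"] inE[OF that] sub Lpr by auto
  obtain x0 y0 where xy0: "x0 \<in> edom f" "y0 \<in> edom g" using f g by (auto simp: proper_def)
  \<comment> \<open>If \<open>r\<close> were negative, a large \<open>e\<close> would push the functional to \<open>- 1\<close> or below on \<open>E_F\<close>.\<close>
  have r0: "r \<ge> 0"
  proof (rule ccontr)
    assume "\<not> r \<ge> 0"
    then have neg: "r < 0" by simp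
    define a where "a = p (x0 - y0) + r * h x0 y0"
    define e where "e = (1 + \<bar>a\<bar>) / (- r)"
    have "e \<ge> 0" using neg by (simp add: e_def divide_nonneg_neg)
    moreover have "r * e = - (1 + \<bar>a\<bar>)" using neg by (simp add: e_def)
    ultimately show False using nonneg[OF xy0, of e] by (simp add: a_def algebra_simps)
  qed
  have "r \<noteq> 0"
  proof
    assume r: "r = 0"
    then have "p (x - y) \<ge> 0" if "x \<in> edom f" "y \<in> edom g" for x y
      using nonneg[OF that, of 0] by simp
    then have zero: "p (x - y) = 0" if "x \<in> edom f" "y \<in> edom g" for x y
      using nonvert[OF pdual] that by blast
    \<comment> \<open>Then \<open>L\<close> vanishes on \<open>E_F\<close> and hence on its hull, against \<open>L u > 0\<close>.\<close>
    have "E_F f g \<union> {(0, 0)} \<subseteq> {w. L w = 0}"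
      using zero r linear_0[OF plin] unfolding E by (auto simp: Lpr)
    moreover have "convex {w. L w = 0}"
      by (auto simp: convex_def linear_add[OF lin] linear_scale[OF lin])
    ultimately have "?U \<subseteq> {w. L w = 0}" by (rule hull_minimal)
    then show False using u by auto
  qed
  then have r: "r > 0" using r0 by simp
  define q where "q x = p x / r" for x
  have "q \<in> topological_dual"
    using pdual r unfolding topological_dual_def q_def
    by (auto intro!: linearI continuous_intros simp: linear_add linear_scale field_simps)
  moreover have "dual_objective f g q \<ge> ereal v"
  proof (rule dual_objective_ge[OF f g])
    fix x y assume xy: "x \<in> edom f" "y \<in> edom g"
    have "(p x - p y) + r * h x y \<ge> 0" using nonneg[OF xy, of 0] by (simp add: linear_diff[OF plin])
    then have "((p x - p y) + r * h x y) / r \<ge> 0" using r by (simp add: divide_nonneg_pos)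
    then show "q x - q y + real_of_ereal (f x) + real_of_ereal (g y) - v \<ge> 0"
      using r by (simp add: q_def h_def field_simps)
  qed
  ultimately show ?thesis
    using strong_duality_of_functional[OF f g] v by metis
qed

theorem theorem15:
  fixes f g :: "'a::locally_convex_space \<Rightarrow> ereal"
  assumes "proper f" and "proper g"
    and "\<bar>primal_value f g\<bar> \<noteq> \<infinity>"
    and "convex (E_F f g)"
    and "(ereal_convex f \<and> ereal_convex g \<and>
            edom f \<inter> qri (edom g) \<noteq> {} \<and>
            0 \<in> qi (minkowski_diff (edom g) (edom g)) \<and>
            (0, 0) \<notin> qri (convex hull (E_F f g \<union> {(0, 0)})))
       \<or> (0 \<in> qi (minkowski_diff (edom f) (edom g)) \<and>
            (0, 0) \<notin> qri (convex hull (E_F f g \<union> {(0, 0)})))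
       \<or> (0 \<in> qi (minkowski_diff (minkowski_diff (edom f) (edom g))
                                   (minkowski_diff (edom f) (edom g))) \<and>
            0 \<in> qri (minkowski_diff (edom f) (edom g)) \<and>
            (0, 0) \<notin> qri (convex hull (E_F f g \<union> {(0, 0)})))"
  shows "primal_value f g = dual_value f g \<and> (\<exists>y. dual_optimal_solution f g y)"
proof (rule strong_duality_of_nonvertical_separation[OF assms(1-3)])
  show "(0, 0) \<notin> qri (convex hull (E_F f g \<union> {(0, 0)}))" using assms(5) by blast
next
  fix p :: "'a \<Rightarrow> real" and x y
  assume p: "p \<in> topological_dual"
    and nn: "\<And>x y. x \<in> edom f \<Longrightarrow> y \<in> edom g \<Longrightarrow> p (x - y) \<ge> 0"
    and xy: "x \<in> edom f" "y \<in> edom g"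
  let ?D = "minkowski_diff (edom f) (edom g)"
  have lin: "linear p" using p by (simp add: topological_dual_def)
  have nnD: "p d \<ge> 0" if "d \<in> ?D" for d using that nn by (auto simp: minkowski_diff_def)
  have xyD: "x - y \<in> ?D" using xy by (auto simp: minkowski_diff_def)
  from assms(5) consider
      x0 where "x0 \<in> edom f" "x0 \<in> qri (edom g)" "0 \<in> qi (minkowski_diff (edom g) (edom g))"
    | "subspace (closure (generated_cone ?D))"
    by (auto simp: qi_def qri_def)
  then show "p (x - y) = 0"
  proof cases
    case (1 x0)
    have const: "p w = p x0" if "w \<in> edom g" for w
    proof -
      have "(\<lambda>x. - p x) \<in> topological_dual"
        using p by (auto simp: topological_dual_def intro: linear_compose_neg continuous_on_minus)
      moreover have "- p d \<ge> 0" if "d \<in> (\<lambda>x. x - x0) ` edom g" for d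
        using that nn[OF 1(1)] by (auto simp: linear_diff[OF lin])
      ultimately have "- p (w - x0) = 0"
        by (rule dual_vanishes_of_subspace) (use 1(2) that in \<open>auto simp: qri_def\<close>)
      then show ?thesis by (simp add: linear_diff[OF lin])
    qed
    have "p d = 0" if "d \<in> minkowski_diff (edom g) (edom g)" for d
      using that const by (auto simp: minkowski_diff_def linear_diff[OF lin])
    then have "p w \<ge> 0" for w
      using dual_nonneg_closure_cone[OF p, of "minkowski_diff (edom g) (edom g)" w] 1(3)
      by (auto simp: qi_def)
    from this[of "x - y"] this[of "- (x - y)"] show ?thesis
      unfolding linear_neg[OF lin] by simp
  next
    case 2
    then show ?thesis using dual_vanishes_of_subspace[OF p nnD _ xyD] by blast
  qed
qed

end
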